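(* Let $k$ be a field and let $m, n \in \mathbb{N}$. Let $T := k[x_{i\beta\gamma} \mid 1 \le i \le m,\ 1 \le \beta, \gamma \le n]$ be a polynomial ring over $k$ in $mn^2$ indeterminates, and for $i = 1, \ldots, m$ let $M_i := (x_{i\beta\gamma})_{\beta,\gamma=1}^n \in M_n(T)$ be the corresponding generic matrices. If $m > n$, then the following identity holds in $T$: \[ \sum_{S \subseteq [m]} (-1)^{|S|} \det\left( \sum_{i \in S} M_i \right) = 0. \] In particular, $\det\left( \sum_{i=1}^m M_i \right)$ belongs to the ideal of $T$ generated by the elements $\det\left( \sum_{i \in S} M_i \right)$ with $S \subseteq [m]$ and $|S| \le n$: \[ \det\left( \sum_{i=1}^m M_i \right) \in \left( \det\left( \sum_{i \in S} M_i \right) \;\Big|\; S \subseteq [m],\ |S| \le n \right). \]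
   Context: $[m] = \{1, \ldots, m\}$, and $|S|$ denotes the cardinality of $S$. $M_n(T)$ is the ring of $n \times n$ matrices over $T$. $\mathbb{N}$ is the set of nonnegative integers. The sum over the empty subset $S = \emptyset$ is the zero matrix. *)

theory Defs
  imports
    "HOL-Library.Poly_Mapping"
    "Jordan_Normal_Form.Determinant"
    "HOL-Algebra.Ideal"
begin

text \<open>
  Polynomials over \<open>'k\<close> with indeterminates in \<open>'x\<close>: finitely supported functions from monomials
  (finitely supported exponent functions) to coefficients; the class instances of
  \<^type>\<open>poly_mapping\<close> supply the convolution product.
\<close>

type_synonym ('x, 'k) mpoly = "('x \<Rightarrow>\<^sub>0 nat) \<Rightarrow>\<^sub>0 'k"

definition indet :: "'x \<Rightarrow> ('x, 'k::zero_neq_one) mpoly" where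
  "indet v = Poly_Mapping.single (Poly_Mapping.single v 1) 1"

definition indets :: "('x, 'k::zero) mpoly \<Rightarrow> 'x set" where
  "indets p = (\<Union>t \<in> Poly_Mapping.keys p. Poly_Mapping.keys t)"

text \<open>
  The number of indeterminates depends on natural numbers, so the polynomial ring \<open>k[V]\<close> in a
  given set \<open>V\<close> of indeterminates cannot be a type; it is the ring with carrier the polynomials
  involving only indeterminates from \<open>V\<close>.
\<close>

definition mpoly_ring :: "'x set \<Rightarrow> ('x, 'k::comm_ring_1) mpoly ring" where
  "mpoly_ring V =
    \<lparr>carrier = {p. indets p \<subseteq> V}, mult = (*), one = 1, zero = 0, add = (+)\<rparr>"

text \<open>The triple \<open>(i, \<beta>, \<gamma>)\<close> names the indeterminate \<open>x\<^sub>i\<^sub>\<beta>\<^sub>\<gamma>\<close>.\<close>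

definition generic_ring :: "nat \<Rightarrow> nat \<Rightarrow> (nat \<times> nat \<times> nat, 'k::comm_ring_1) mpoly ring" where
  "generic_ring m n = mpoly_ring ({1..m} \<times> {1..n} \<times> {1..n})"

text \<open>
  Matrix positions are counted from 0 in \<^const>\<open>mat\<close>, whereas the indices of the indeterminates
  start at 1; hence the successors.
\<close>

definition generic_mat :: "nat \<Rightarrow> nat \<Rightarrow> (nat \<times> nat \<times> nat, 'k::comm_ring_1) mpoly mat" where
  "generic_mat n i = mat n n (\<lambda>(\<beta>, \<gamma>). indet (i, Suc \<beta>, Suc \<gamma>))"

definition generic_sum :: "nat \<Rightarrow> nat set \<Rightarrow> (nat \<times> nat \<times> nat, 'k::comm_ring_1) mpoly mat" where
  "generic_sum n S =
    (\<Oplus>\<^bsub>ring_mat TYPE((nat \<times> nat \<times> nat, 'k) mpoly) n ()\<^esub> i \<in> S. generic_mat n i)"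

lemma indets_zero: "indets 0 = {}"
  by (simp add: indets_def)

lemma indets_one: "indets (1 :: ('x, 'k::comm_ring_1) mpoly) = {}"
  by (simp add: indets_def)

lemma indets_uminus: "indets (- p) = indets (p :: ('x, 'k::comm_ring_1) mpoly)"
proof -
  have "Poly_Mapping.keys (- p) = Poly_Mapping.keys p"
    by (auto simp: in_keys_iff)
  then show ?thesis by (simp add: indets_def)
qed

lemma indets_add: "indets (p + q) \<subseteq> indets p \<union> indets (q :: ('x, 'k::comm_ring_1) mpoly)"
  unfolding indets_def using Poly_Mapping.keys_add[of p q] by blast

lemma indets_mult: "indets (p * q) \<subseteq> indets p \<union> indets (q :: ('x, 'k::comm_ring_1) mpoly)"
proof
  fix v assume "v \<in> indets (p * q)"
  then obtain t where t: "t \<in> Poly_Mapping.keys (p * q)" "v \<in> Poly_Mapping.keys t"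
    by (auto simp: indets_def)
  then obtain a b where ab: "t = a + b" "a \<in> Poly_Mapping.keys p" "b \<in> Poly_Mapping.keys q"
    using keys_mult[of p q] by blast
  have "v \<in> Poly_Mapping.keys a \<union> Poly_Mapping.keys b"
    using t(2) Poly_Mapping.keys_add[of a b] ab(1) by blast
  then show "v \<in> indets p \<union> indets q"
    using ab by (auto simp: indets_def)
qed

lemma indets_indet: "indets (indet v :: ('x, 'k::comm_ring_1) mpoly) = {v}"
  by (simp add: indets_def indet_def)

lemma indets_sum:
  "(\<And>i. i \<in> A \<Longrightarrow> indets (f i) \<subseteq> V) \<Longrightarrow> indets (\<Sum>i\<in>A. f i :: ('x, 'k::comm_ring_1) mpoly) \<subseteq> V"
proof (induction A rule: infinite_finite_induct)
  case (insert a A)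
  have "indets (f a) \<union> indets (sum f A) \<subseteq> V"
    using insert.IH insert.prems by simp
  then show ?case
    using subset_trans[OF indets_add] insert.hyps by (metis sum.insert)
qed (simp_all add: indets_zero)

lemma indets_prod:
  "(\<And>i. i \<in> A \<Longrightarrow> indets (f i) \<subseteq> V) \<Longrightarrow> indets (\<Prod>i\<in>A. f i :: ('x, 'k::comm_ring_1) mpoly) \<subseteq> V"
proof (induction A rule: infinite_finite_induct)
  case (insert a A)
  have "indets (f a) \<union> indets (prod f A) \<subseteq> V"
    using insert.IH insert.prems by simp
  then show ?case
    using subset_trans[OF indets_mult] insert.hyps by (metis prod.insert)
qed (simp_all add: indets_one)

lemma cring_mpoly_ring: "cring (mpoly_ring V)"
proof (rule cringI)
  have add: "indets (p + q) \<subseteq> V" and mult: "indets (p * q) \<subseteq> V"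
    if "indets p \<subseteq> V" "indets q \<subseteq> V" for p q :: "('x, 'k::comm_ring_1) mpoly" and V
    using that indets_add[of p q] indets_mult[of p q] by blast+
  show "abelian_group (mpoly_ring V)"
  proof (rule abelian_groupI)
    fix p assume "p \<in> carrier (mpoly_ring V)"
    then show "\<exists>q\<in>carrier (mpoly_ring V). q \<oplus>\<^bsub>mpoly_ring V\<^esub> p = \<zero>\<^bsub>mpoly_ring V\<^esub>"
      by (intro bexI[of _ "- p"]) (simp_all add: mpoly_ring_def indets_uminus)
  qed (simp_all add: mpoly_ring_def indets_zero add ac_simps)
  show "Group.comm_monoid (mpoly_ring V)"
    by (rule comm_monoidI) (simp_all add: mpoly_ring_def indets_one mult ac_simps)
qed (simp add: mpoly_ring_def distrib_right)

lemma generic_mat_closed [simp]: "generic_mat n i \<in> carrier_mat n n"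
  by (simp add: generic_mat_def)

lemma
  assumes "finite S"
  shows generic_sum_closed:
      "(generic_sum n S :: (nat \<times> nat \<times> nat, 'k::comm_ring_1) mpoly mat) \<in> carrier_mat n n"
    and generic_sum_index: "\<beta> < n \<Longrightarrow> \<gamma> < n \<Longrightarrow>
      generic_sum n S $$ (\<beta>, \<gamma>)
        = (\<Sum>i\<in>S. indet (i, Suc \<beta>, Suc \<gamma>) :: (nat \<times> nat \<times> nat, 'k) mpoly)"
proof -
  let ?R = "ring_mat TYPE((nat \<times> nat \<times> nat, 'k) mpoly) n ()"
  let ?M = "generic_sum n :: nat set \<Rightarrow> (nat \<times> nat \<times> nat, 'k) mpoly mat"
  interpret R: Ring.ring ?R by (rule ring_mat)
  have car: "generic_mat n \<in> A \<rightarrow> carrier ?R" for A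
    by (simp add: ring_mat_simps)
  show cl: "?M S \<in> carrier_mat n n"
    using R.finsum_closed[OF car] by (simp add: generic_sum_def ring_mat_simps)
  show "?M S $$ (\<beta>, \<gamma>) = (\<Sum>i\<in>S. indet (i, Suc \<beta>, Suc \<gamma>))" if "\<beta> < n" "\<gamma> < n"
    using assms
  proof (induction S)
    case empty
    then show ?case
      using R.finsum_empty that by (simp add: generic_sum_def ring_mat_simps)
  next
    case (insert a A)
    have "?M A \<in> carrier_mat n n"
      using R.finsum_closed[OF car] by (simp add: generic_sum_def ring_mat_simps)
    moreover have "?M (insert a A) = generic_mat n a + ?M A"
      unfolding generic_sum_def
      using R.finsum_insert[OF insert(1,2) car] by (simp add: ring_mat_simps)
    ultimately show ?case
      using insert that by (simp add: generic_mat_def)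
  qed
qed

lemma det_generic_sum_closed:
  assumes "S \<subseteq> {1..m}"
  shows "det (generic_sum n S) \<in> carrier (generic_ring m n)"
proof -
  let ?V = "{1..m} \<times> {1..n} \<times> {1..n}"
  let ?A = "generic_sum n S :: (nat \<times> nat \<times> nat, 'a) mpoly mat"
  have fin: "finite S" using assms finite_subset by blast
  have entry: "indets (?A $$ (i, j)) \<subseteq> ?V" if "i < n" "j < n" for i j
    unfolding generic_sum_index[OF fin that]
    by (rule indets_sum) (use assms that in \<open>auto simp: indets_indet\<close>)
  have sgn: "indets (signof p * q) \<subseteq> ?V" if "indets q \<subseteq> ?V"
    for p :: "nat \<Rightarrow> nat" and q :: "(nat \<times> nat \<times> nat, 'a) mpoly"
    using that by (simp add: sign_def indets_uminus)
  have "indets (det ?A) \<subseteq> ?V"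
    unfolding det_def'[OF generic_sum_closed[OF fin]]
    by (intro indets_sum sgn indets_prod entry) (auto dest: permutes_in_image)
  then show ?thesis by (simp add: generic_ring_def mpoly_ring_def)
qed

end

theory Submission
  imports Defs
begin

text \<open>
  Expand each product of row sums over the maps \<open>f\<close> from the row positions to the summands. The
  contribution of \<open>f\<close> to the alternating sum is a multiple of \<open>\<Sum>(-1)\<^bsup>|S|\<^esup>\<close> over the \<open>S \<subseteq> [m]\<close>
  that contain the image of \<open>f\<close>; as \<open>m > n\<close>, this image misses some \<open>a\<close>, and toggling the membership
  of \<open>a\<close> in \<open>S\<close> cancels the terms in pairs. The identity for each index set with more than \<open>n\<close>
  elements expresses its determinant by those of its proper subsets, so the statement on the ideal
  follows by induction on the cardinality.
\<close>

text \<open>Passing from \<open>S\<close> to \<open>insert a S\<close> flips the sign and preserves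
  \<open>g\<close>, so the subsets of \<open>I\<close> cancel in pairs.\<close>

lemma alternating_sum_insert_invariant:
  fixes g :: "'a set \<Rightarrow> 'r::comm_ring_1"
  assumes "finite I" "a \<in> I" "\<And>S. a \<notin> S \<Longrightarrow> g (insert a S) = g S"
  shows "(\<Sum>S\<in>Pow I. (-1) ^ card S * g S) = 0"
proof -
  define J where "J = I - {a}"
  have I: "I = insert a J" "a \<notin> J" "finite J"
    using assms by (auto simp: J_def)
  have inj: "inj_on (insert a) (Pow J)"
    using I(2) by (intro inj_onI) (metis PowD insert_ident subsetD)
  have "(\<Sum>S\<in>insert a ` Pow J. (-1) ^ card S * g S)
      = (\<Sum>S\<in>Pow J. (-1) ^ card (insert a S) * g (insert a S))"
    by (simp add: sum.reindex[OF inj])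
  also have "\<dots> = (\<Sum>S\<in>Pow J. - ((-1) ^ card S * g S))"
  proof (rule sum.cong[OF refl])
    fix S assume "S \<in> Pow J"
    then have "a \<notin> S" "finite S" using I finite_subset by auto
    then show "(-1) ^ card (insert a S) * g (insert a S) = - ((-1) ^ card S * g S)"
      using assms(3) by simp
  qed
  finally have "(\<Sum>S\<in>insert a ` Pow J. (-1) ^ card S * g S) = - (\<Sum>S\<in>Pow J. (-1) ^ card S * g S)"
    by (simp add: sum_negf)
  moreover have "Pow J \<inter> insert a ` Pow J = {}" using I(2) by auto
  ultimately show ?thesis
    using I by (simp add: Pow_insert sum.union_disjoint)
qed

lemma alternating_sum_prod_sum:
  fixes x :: "'b \<Rightarrow> 'a \<Rightarrow> 'r::comm_ring_1"
  assumes "finite I" "finite J" "card J < card I"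
  shows "(\<Sum>S\<in>Pow I. (-1) ^ card S * (\<Prod>j\<in>J. \<Sum>i\<in>S. x j i)) = 0"
proof -
  let ?E = "\<lambda>S. J \<rightarrow>\<^sub>E S" and ?w = "\<lambda>f. \<Prod>j\<in>J. x j (f j)"
  \<comment> \<open>The indicator moves the dependence on \<open>S\<close> from the range of
    summation into the terms, so that the sums over \<open>S\<close> and \<open>f\<close> can be
    swapped.\<close>
  have expand: "(\<Prod>j\<in>J. \<Sum>i\<in>S. x j i) = (\<Sum>f\<in>?E I. of_bool (f \<in> ?E S) * ?w f)" if "S \<subseteq> I" for S
  proof -
    have "finite S" using that assms(1) finite_subset by blast
    then have "(\<Prod>j\<in>J. \<Sum>i\<in>S. x j i) = (\<Sum>f\<in>?E S. ?w f)"
      using assms(2) by (simp add: prod_sum_PiE)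
    also have "?E S = ?E I \<inter> {f. f \<in> ?E S}"
      using that by (auto simp: PiE_def Pi_def)
    also have "(\<Sum>f\<in>?E I \<inter> {f. f \<in> ?E S}. ?w f) = (\<Sum>f\<in>?E I. if f \<in> ?E S then ?w f else 0)"
      using sum.inter_restrict[OF finite_PiE[OF assms(2), of "\<lambda>_. I"], of ?w "{f. f \<in> ?E S}"]
        assms(1) by simp
    also have "\<dots> = (\<Sum>f\<in>?E I. of_bool (f \<in> ?E S) * ?w f)"
      by (intro sum.cong) auto
    finally show ?thesis .
  qed
  have "(\<Sum>S\<in>Pow I. (-1) ^ card S * (\<Prod>j\<in>J. \<Sum>i\<in>S. x j i))
      = (\<Sum>S\<in>Pow I. \<Sum>f\<in>?E I. (-1) ^ card S * (of_bool (f \<in> ?E S) * ?w f))"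
    by (intro sum.cong refl) (simp add: expand sum_distrib_left)
  also have "\<dots> = (\<Sum>f\<in>?E I. \<Sum>S\<in>Pow I. (-1) ^ card S * (of_bool (f \<in> ?E S) * ?w f))"
    by (rule sum.swap)
  also have "\<dots> = (\<Sum>f\<in>?E I. 0)"
  proof (rule sum.cong[OF refl])
    fix f assume "f \<in> ?E I"
    have "card (f ` J) < card I"
      using card_image_le[OF assms(2), of f] assms(3) by linarith
    then obtain a where a: "a \<in> I" "a \<notin> f ` J"
      using assms(2) by (metis card_mono finite_imageI linorder_not_less subsetI)
    \<comment> \<open>Since \<open>f\<close> never takes the value \<open>a\<close> on
      \<open>J\<close>, the condition \<open>f \<in> ?E S\<close> is unaffected by inserting
      \<open>a\<close> into \<open>S\<close>.\<close>
    show "(\<Sum>S\<in>Pow I. (-1) ^ card S * (of_bool (f \<in> ?E S) * ?w f)) = 0"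
      using assms(1) a by (intro alternating_sum_insert_invariant) (auto simp: PiE_def Pi_def)
  qed
  finally show ?thesis by simp
qed

text \<open>In the Leibniz expansion, each permutation contributes an alternating sum of products of
  \<open>n\<close> row sums, which vanishes separately. The index set is arbitrary because the
  induction for the ideal applies the identity to subsets.\<close>

lemma alternating_sum_det_generic_sum:
  assumes "finite I" "n < card I"
  shows "(\<Sum>S\<in>Pow I. (-1) ^ card S *
           det (generic_sum n S :: (nat \<times> nat \<times> nat, 'k::comm_ring_1) mpoly mat)) = 0"
proof -
  let ?P = "{p. p permutes {0..<n}}"
  let ?x = "\<lambda>p j i. indet (i, Suc j, Suc (p j)) :: (nat \<times> nat \<times> nat, 'k) mpoly"
  have "(-1) ^ card S * det (generic_sum n S)
      = (\<Sum>p\<in>?P. signof p * ((-1) ^ card S * (\<Prod>j\<in>{0..<n}. \<Sum>i\<in>S. ?x p j i)))"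
    if "S \<in> Pow I" for S
  proof -
    have S: "finite S" using that assms(1) finite_subset by blast
    show ?thesis
      unfolding det_def'[OF generic_sum_closed[OF S]] sum_distrib_left
    proof (rule sum.cong[OF refl])
      fix p assume "p \<in> ?P"
      then have "p j < n" if "j < n" for j using that by (auto dest: permutes_in_image)
      then have "(\<Prod>j = 0..<n. generic_sum n S $$ (j, p j)) = (\<Prod>j = 0..<n. \<Sum>i\<in>S. ?x p j i)"
        by (intro prod.cong) (auto simp: generic_sum_index[OF S])
      then show "(-1) ^ card S * (signof p * (\<Prod>j = 0..<n. generic_sum n S $$ (j, p j)))
          = signof p * ((-1) ^ card S * (\<Prod>j = 0..<n. \<Sum>i\<in>S. ?x p j i))"
        by (simp add: mult.left_commute)
    qed
  qed
  then have "(\<Sum>S\<in>Pow I. (-1) ^ card S * det (generic_sum n S))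
      = (\<Sum>S\<in>Pow I. \<Sum>p\<in>?P. signof p * ((-1) ^ card S * (\<Prod>j\<in>{0..<n}. \<Sum>i\<in>S. ?x p j i)))"
    by (rule sum.cong[OF refl])
  also have "\<dots> = (\<Sum>p\<in>?P. signof p * (\<Sum>S\<in>Pow I. (-1) ^ card S * (\<Prod>j\<in>{0..<n}. \<Sum>i\<in>S. ?x p j i)))"
    unfolding sum_distrib_left by (rule sum.swap)
  also have "\<dots> = 0"
    using assms by (simp add: alternating_sum_prod_sum)
  finally show ?thesis .
qed

lemma ideal_mpoly_ring_sum:
  assumes "ideal A (mpoly_ring V)" "\<And>i. i \<in> B \<Longrightarrow> f i \<in> A"
  shows "(\<Sum>i\<in>B. f i) \<in> A"
proof -
  interpret ideal A "mpoly_ring V" by (fact assms(1))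
  show ?thesis
    using assms(2)
  proof (induction B rule: infinite_finite_induct)
    case (insert b B)
    then show ?case
      using additive_subgroup.a_closed[OF additive_subgroup_axioms, of "f b" "sum f B"]
      by (simp add: mpoly_ring_def)
  qed (use additive_subgroup.zero_closed[OF additive_subgroup_axioms] in
      \<open>simp_all add: mpoly_ring_def\<close>)
qed

text \<open>A sign is a constant polynomial, hence lies in the carrier for every \<open>V\<close>,
  and the ideal absorbs it.\<close>

lemma ideal_mpoly_ring_sign:
  assumes "ideal A (mpoly_ring V)" "p \<in> A"
  shows "(-1) ^ k * p \<in> A"
proof -
  interpret ideal A "mpoly_ring V" by (fact assms(1))
  have "(-1) ^ k \<in> carrier (mpoly_ring V)"
    by (simp add: mpoly_ring_def minus_one_power_iff indets_uminus indets_one)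
  then show ?thesis
    using I_l_closed[OF assms(2)] by (simp add: mpoly_ring_def)
qed

text \<open>Strong induction along proper subsets: when \<open>card S > n\<close>, the alternating
  identity makes the determinant for \<open>S\<close> a combination, with signs as coefficients, of
  those for proper subsets.\<close>

lemma det_generic_sum_in_ideal:
  fixes A :: "(nat \<times> nat \<times> nat, 'k::comm_ring_1) mpoly set"
  assumes A: "ideal A (mpoly_ring V)"
    and small: "\<And>T. T \<subseteq> S \<Longrightarrow> card T \<le> n \<Longrightarrow> det (generic_sum n T) \<in> A"
    and "finite S"
  shows "det (generic_sum n S) \<in> A"
  using assms(3) small
proof (induction S rule: finite_psubset_induct)
  case (psubset S)
  show ?case
  proof (cases "card S \<le> n")
    case True
    then show ?thesis using psubset.prems by blast
  next
    case False
    let ?d = "\<lambda>T. det (generic_sum n T) :: (nat \<times> nat \<times> nat, 'k) mpoly"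
    let ?r = "\<Sum>T\<in>Pow S - {S}. (-1) ^ card T * ?d T"
    \<comment> \<open>The assumption on small subsets of \<open>S\<close> restricts to small subsets
      of \<open>T\<close>, as the induction hypothesis requires.\<close>
    have "?d T \<in> A" if "T \<in> Pow S - {S}" for T
      using psubset.IH[of T] psubset.prems that by blast
    then have "?r \<in> A"
      by (intro ideal_mpoly_ring_sum[OF A] ideal_mpoly_ring_sign[OF A])
    \<comment> \<open>The identity gives \<open>?r\<close> as the negative of the signed term for
      \<open>S\<close>; the extra factor of -1 in this sign turns it into \<open>?d S\<close>
      itself.\<close>
    then have "(-1) ^ Suc (card S) * ?r \<in> A"
      by (rule ideal_mpoly_ring_sign[OF A])
    moreover have "(-1) ^ card S * ?d S + ?r = 0"
      using alternating_sum_det_generic_sum[of S n, where 'k = 'k] psubset.hyps False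
      by (simp add: sum.remove[of "Pow S" S])
    then have "?r = - ((-1) ^ card S * ?d S)"
      by (simp add: add_eq_0_iff)
    then have "(-1) ^ Suc (card S) * ?r = ?d S"
      by (simp add: minus_one_power_iff)
    ultimately show ?thesis by simp
  qed
qed

theorem lemma2:
  fixes m n :: nat
  assumes "m > n"
  shows "(\<Sum>S\<in>Pow {1..m}. (-1) ^ card S *
           det (generic_sum n S :: (nat \<times> nat \<times> nat, 'k::field) mpoly mat)) = 0 \<and>
         det (generic_sum n {1..m} :: (nat \<times> nat \<times> nat, 'k) mpoly mat)
           \<in> Idl\<^bsub>generic_ring m n\<^esub> {det (generic_sum n S) | S. S \<subseteq> {1..m} \<and> card S \<le> n}"
proof
  show "(\<Sum>S\<in>Pow {1..m}. (-1) ^ card S *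
           det (generic_sum n S :: (nat \<times> nat \<times> nat, 'k) mpoly mat)) = 0"
    using assms by (intro alternating_sum_det_generic_sum) simp_all
  let ?R = "generic_ring m n :: (nat \<times> nat \<times> nat, 'k) mpoly ring"
  let ?G = "{det (generic_sum n S) | S. S \<subseteq> {1..m} \<and> card S \<le> n}
    :: (nat \<times> nat \<times> nat, 'k) mpoly set"
  interpret cring ?R
    unfolding generic_ring_def by (rule cring_mpoly_ring)
  have G: "?G \<subseteq> carrier ?R"
    using det_generic_sum_closed by blast
  show "det (generic_sum n {1..m}) \<in> Idl\<^bsub>?R\<^esub> ?G"
  proof (rule det_generic_sum_in_ideal)
    show "ideal (Idl\<^bsub>?R\<^esub> ?G) (mpoly_ring ({1..m} \<times> {1..n} \<times> {1..n}))"
      using genideal_ideal[OF G] by (simp add: generic_ring_def)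
    show "det (generic_sum n T) \<in> Idl\<^bsub>?R\<^esub> ?G" if "T \<subseteq> {1..m}" "card T \<le> n" for T
      using genideal_self[OF G] that by blast
  qed simp
qed

end
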